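(* Let $M=\operatorname{Inv}\langle A\mid r_i=1\ (i\in I)\rangle$ be a special inverse monoid, and for each $i\in I$ let $r_i\equiv r_{i1}r_{i2}\cdots r_{ik_i}$ be a factorisation into invertible pieces. Let $H$ be the subgroup of the free group $F_A$ generated by (the elements represented by) all the pieces $r_{ij}$ ($i\in I$, $1\le j\le k_i$). Fix an isomorphism $\phi:F_Y\to H$ from a free group $F_Y$, and set \[ K=\operatorname{Gp}\langle Y\mid \phi^{-1}(r_{i1})\phi^{-1}(r_{i2})\cdots\phi^{-1}(r_{ik_i})=1\ (i\in I)\rangle . \] If $\phi$ induces an embedding of the group $K$ into the group $\operatorname{Gp}\langle A\mid r_i=1\ (i\in I)\rangle$ defined by the same presentation as $M$, then $\phi$ induces an isomorphism between $K$ and the subgroup of the monoid $M$ generated by the pieces.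
   Context: For an alphabet $A$, let $A^{-1}=\{a^{-1}:a\in A\}$ be a disjoint copy, $\overline A=A\cup A^{-1}$, and $\overline A^*$ the free monoid on $\overline A$, with formal inverses of words defined in the usual way. Equality of words in $\overline A^*$ is written $\equiv$. For $w\in\overline A^*$, $\operatorname{red}(w)$ is its free reduction; the free group $F_A$ is identified with the set of reduced words under $u\cdot v=\operatorname{red}(uv)$. A word $w\in\overline A^*$ represents the element $\operatorname{red}(w)$ of $F_A$, and $\phi^{-1}(r_{ij})$ means $\phi^{-1}(\operatorname{red}(r_{ij}))$. $\operatorname{Inv}\langle A\mid R\rangle$ is the inverse monoid defined by generators $A$ and relations $R\subseteq\overline A^*\times\overline A^*$ (the quotient of the free inverse monoid on $A$ by the congruence generated by $R$); it is special if all relations have the form $u=1$. $\operatorname{Gp}\langle A\mid R\rangle$ is the group defined by the presentation. A factorisation $r_i\equiv r_{i1}\cdots r_{ik_i}$ is into invertible pieces if every word $r_{ij}$ represents an invertible (two-sided) element of $M$. The map induced by $\phi$ from $K$ to $\operatorname{Gp}\langle A\mid r_i=1\ (i\in I)\rangle$ (respectively to $M$) is the one sending the element represented by $y\in Y$ to the element represented by the word $\phi(y)$. *)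

theory Defs
  imports "HOL-Algebra.Elementary_Groups" "HOL.Hull"
begin

text \<open>The letter \<open>Inl a\<close> is the generator \<open>a\<close> and \<open>Inr a\<close> is its formal inverse.\<close>

type_synonym 'a gword = "('a + 'a) list"

definition gwords :: "'a set \<Rightarrow> 'a gword set"
  where "gwords A = lists (A <+> A)"

definition linv :: "'a + 'a \<Rightarrow> 'a + 'a"
  where "linv = case_sum Inr Inl"

definition winv :: "'a gword \<Rightarrow> 'a gword"
  where "winv w = rev (map linv w)"

definition reduced :: "'a gword \<Rightarrow> bool"
  where "reduced = successively (\<lambda>x y. y \<noteq> linv x)"

fun rcons :: "'a + 'a \<Rightarrow> 'a gword \<Rightarrow> 'a gword" where
  "rcons x [] = [x]"
| "rcons x (y # ys) = (if y = linv x then ys else x # y # ys)"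

definition red :: "'a gword \<Rightarrow> 'a gword"
  where "red w = foldr rcons w []"

definition free_group :: "'a set \<Rightarrow> 'a gword monoid"
  where "free_group A =
    \<lparr>carrier = {w \<in> gwords A. reduced w}, mult = (\<lambda>u v. red (u @ v)), one = []\<rparr>"

definition normal_closure :: "('g, 'm) monoid_scheme \<Rightarrow> 'g set \<Rightarrow> 'g set"
  where "normal_closure G S = (\<lambda>N. N \<lhd> G) hull S"

definition gp_kernel :: "'a set \<Rightarrow> ('a gword \<times> 'a gword) set \<Rightarrow> 'a gword set"
  where "gp_kernel A R =
    normal_closure (free_group A) ((\<lambda>(u, v). red (u @ winv v)) ` R)"

definition Gp :: "'a set \<Rightarrow> ('a gword \<times> 'a gword) set \<Rightarrow> 'a gword set monoid"
  where "Gp A R = free_group A Mod gp_kernel A R"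

text \<open>The element of \<open>Gp A R\<close> represented by a word.\<close>

definition gp_elem :: "'a set \<Rightarrow> ('a gword \<times> 'a gword) set \<Rightarrow> 'a gword \<Rightarrow> 'a gword set"
  where "gp_elem A R w = gp_kernel A R #>\<^bsub>free_group A\<^esub> red w"

definition monoid_congruence :: "('m, 'e) monoid_scheme \<Rightarrow> ('m \<times> 'm) set \<Rightarrow> bool"
  where "monoid_congruence M \<theta> \<longleftrightarrow>
    equiv (carrier M) \<theta> \<and>
    (\<forall>(a, b) \<in> \<theta>. \<forall>(c, d) \<in> \<theta>. (a \<otimes>\<^bsub>M\<^esub> c, b \<otimes>\<^bsub>M\<^esub> d) \<in> \<theta>)"

definition generated_congruence ::
    "('m, 'e) monoid_scheme \<Rightarrow> ('m \<times> 'm) set \<Rightarrow> ('m \<times> 'm) set"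
  where "generated_congruence M R = monoid_congruence M hull R"

definition quotient_monoid :: "('m, 'e) monoid_scheme \<Rightarrow> ('m \<times> 'm) set \<Rightarrow> 'm set monoid"
  where "quotient_monoid M \<theta> =
    \<lparr>carrier = carrier M // \<theta>,
     mult = (\<lambda>X Y. \<Union>x\<in>X. \<Union>y\<in>Y. \<theta> `` {x \<otimes>\<^bsub>M\<^esub> y}),
     one = \<theta> `` {\<one>\<^bsub>M\<^esub>}\<rparr>"

definition free_monoid :: "'a set \<Rightarrow> 'a gword monoid"
  where "free_monoid A = \<lparr>carrier = gwords A, mult = (@), one = []\<rparr>"

text \<open>The free inverse monoid is the quotient of the free monoid on \<open>A <+> A\<close> by Vagner's
  congruence, which forces \<open>w w\<^sup>-\<^sup>1 w = w\<close> and makes the elements \<open>u u\<^sup>-\<^sup>1\<close> commute.\<close>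

definition vagner_congruence :: "'a set \<Rightarrow> ('a gword \<times> 'a gword) set"
  where "vagner_congruence A = generated_congruence (free_monoid A)
    ({(w @ winv w @ w, w) | w. w \<in> gwords A} \<union>
     {(u @ winv u @ v @ winv v, v @ winv v @ u @ winv u) | u v. u \<in> gwords A \<and> v \<in> gwords A})"

definition free_inverse_monoid :: "'a set \<Rightarrow> 'a gword set monoid"
  where "free_inverse_monoid A = quotient_monoid (free_monoid A) (vagner_congruence A)"

definition fim_elem :: "'a set \<Rightarrow> 'a gword \<Rightarrow> 'a gword set"
  where "fim_elem A w = vagner_congruence A `` {w}"

definition inv_congruence ::
    "'a set \<Rightarrow> ('a gword \<times> 'a gword) set \<Rightarrow> ('a gword set \<times> 'a gword set) set"
  where "inv_congruence A R = generated_congruence (free_inverse_monoid A)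
    (map_prod (fim_elem A) (fim_elem A) ` R)"

definition Inv :: "'a set \<Rightarrow> ('a gword \<times> 'a gword) set \<Rightarrow> 'a gword set set monoid"
  where "Inv A R = quotient_monoid (free_inverse_monoid A) (inv_congruence A R)"

text \<open>The element of \<open>Inv A R\<close> represented by a word.\<close>

definition inv_elem :: "'a set \<Rightarrow> ('a gword \<times> 'a gword) set \<Rightarrow> 'a gword \<Rightarrow> 'a gword set set"
  where "inv_elem A R w = inv_congruence A R `` {fim_elem A w}"

definition special_relations :: "'i set \<Rightarrow> ('i \<Rightarrow> 'a gword) \<Rightarrow> ('a gword \<times> 'a gword) set"
  where "special_relations I r = (\<lambda>i. (r i, [])) ` I"

end

theory Submission
  imports Defs
begin

text \<open>
  Free reduction does not preserve the element of an inverse monoid that a word represents: deleting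
  \<open>x x\<^sup>-\<^sup>1\<close> can move the element up in the natural partial order. Precisely, every word \<open>w\<close> satisfies
  \<open>w = w w\<^sup>-\<^sup>1 red(w)\<close> in the free inverse monoid (lemma \<open>eq_idempotent_red\<close>). If \<open>w\<close> represents a unit
  of \<open>M\<close>, then \<open>w w\<^sup>-\<^sup>1 = 1\<close> there, so \<open>w\<close> and \<open>red(w)\<close> represent the same element (lemma
  \<open>red_of_unit\<close>). Units are thus the part of \<open>M\<close> on which one may compute in the free group: since
  the pieces are invertible, evaluating reduced words in \<open>M\<close> is a group homomorphism from \<open>H\<close> onto
  the subgroup of \<open>M\<close> generated by the pieces (lemma \<open>epi_subgroup_generated_units\<close>).

  Precomposing with \<open>\<phi>\<close> gives an epimorphism from \<open>F\<^sub>Y\<close>. The relator of \<open>K\<close> with index \<open>i\<close> goes to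
  \<open>red(r\<^sub>i)\<close>, which represents the same element of \<open>M\<close> as \<open>r\<^sub>i\<close>, namely \<open>1\<close>. So the epimorphism
  factors through \<open>K\<close>. It is injective because \<open>M\<close> maps to the group with the same presentation
  (lemma \<open>gp_elem_eq_if_inv_elem_eq\<close>), and the composite from \<open>K\<close> to that group agrees with the
  assumed embedding on the generators \<open>Y\<close>, hence everywhere.
\<close>

section \<open>Words and free reduction\<close>

lemma linv_linv [simp]: "linv (linv x) = x"
  by (cases x) (simp_all add: linv_def)

lemma linv_mem_Plus_iff [simp]: "linv x \<in> A <+> A \<longleftrightarrow> x \<in> A <+> A"
  by (cases x) (auto simp: linv_def)

lemma Nil_in_gwords [simp]: "[] \<in> gwords A"
  by (simp add: gwords_def)

lemma Cons_in_gwords [simp]: "x # w \<in> gwords A \<longleftrightarrow> x \<in> A <+> A \<and> w \<in> gwords A"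
  by (simp add: gwords_def)

lemma append_in_gwords [simp]: "u @ v \<in> gwords A \<longleftrightarrow> u \<in> gwords A \<and> v \<in> gwords A"
  by (simp add: gwords_def)

lemma concat_in_gwords [simp]: "concat ws \<in> gwords A \<longleftrightarrow> set ws \<subseteq> gwords A"
  by (induction ws) auto

lemma winv_Nil [simp]: "winv [] = []"
  by (simp add: winv_def)

lemma winv_Cons: "winv (x # w) = winv w @ [linv x]"
  by (simp add: winv_def)

lemma winv_winv [simp]: "winv (winv w) = w"
  by (simp add: winv_def rev_map comp_def)

lemma winv_in_gwords [simp]: "winv w \<in> gwords A \<longleftrightarrow> w \<in> gwords A"
  by (induction w) (auto simp: winv_Cons)

lemma red_Nil [simp]: "red [] = []"
  by (simp add: red_def)

lemma red_Cons: "red (x # w) = rcons x (red w)"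
  by (simp add: red_def)

lemma reduced_Nil [simp]: "reduced []"
  by (simp add: reduced_def)

lemma reduced_Cons: "reduced (x # w) \<longleftrightarrow> reduced w \<and> (w = [] \<or> hd w \<noteq> linv x)"
  by (cases w) (auto simp: reduced_def)

lemma reduced_rcons: "reduced w \<Longrightarrow> reduced (rcons x w)"
  by (cases w) (auto simp: reduced_Cons)

lemma reduced_red [simp]: "reduced (red w)"
  by (induction w) (auto simp: red_Cons reduced_rcons)

lemma rcons_eq_Cons: "reduced (x # w) \<Longrightarrow> rcons x w = x # w"
  by (cases w) (auto simp: reduced_Cons)

lemma red_of_reduced: "reduced w \<Longrightarrow> red w = w"
  by (induction w) (auto simp: red_Cons rcons_eq_Cons reduced_Cons)

lemma rcons_in_gwords: "x \<in> A <+> A \<Longrightarrow> w \<in> gwords A \<Longrightarrow> rcons x w \<in> gwords A"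
  by (cases w) auto

lemma red_in_gwords [simp]: "w \<in> gwords A \<Longrightarrow> red w \<in> gwords A"
  by (induction w) (auto simp: red_Cons rcons_in_gwords)

text \<open>On reduced words, a letter acts as a permutation whose inverse is the action of the inverse
  letter. This is what makes reduction independent of the order of cancellations.\<close>

lemma rcons_rcons_linv: "reduced w \<Longrightarrow> rcons x (rcons (linv x) w) = w"
  by (cases w) (auto simp: rcons_eq_Cons)

lemma red_rcons_append: "red (rcons x w @ v) = rcons x (red (w @ v))"
  using rcons_rcons_linv[of "red (tl w @ v)" x] by (cases w) (auto simp: red_Cons)

lemma red_append_red_left [simp]: "red (red u @ v) = red (u @ v)"
  by (induction u) (auto simp: red_Cons red_rcons_append)

lemma red_append_red_right [simp]: "red (u @ red v) = red (u @ v)"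
  by (induction u) (auto simp: red_Cons red_of_reduced)

lemma red_winv_right_append: "red (w @ winv w @ v) = red v"
proof (induction w arbitrary: v)
  case (Cons x w)
  have "red ((x # w) @ winv (x # w) @ v) = rcons x (red (w @ winv w @ (linv x # v)))"
    by (simp add: red_Cons winv_Cons)
  then show ?case
    by (simp add: Cons.IH red_Cons rcons_rcons_linv)
qed simp

lemma red_winv_right: "red (w @ winv w) = []"
  using red_winv_right_append[of w "[]"] by simp

lemma red_winv_left: "red (winv w @ w) = []"
  using red_winv_right[of "winv w"] by simp


section \<open>The free group\<close>

lemma free_group_simps [simp]:
  "carrier (free_group A) = {w \<in> gwords A. reduced w}"
  "u \<otimes>\<^bsub>free_group A\<^esub> v = red (u @ v)"
  "\<one>\<^bsub>free_group A\<^esub> = []"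
  by (simp_all add: free_group_def)

lemma group_free_group: "group (free_group A)"
proof (rule groupI)
  fix u assume "u \<in> carrier (free_group A)"
  then show "\<exists>v\<in>carrier (free_group A). v \<otimes>\<^bsub>free_group A\<^esub> u = \<one>\<^bsub>free_group A\<^esub>"
    by (intro bexI[of _ "red (winv u)"]) (auto simp: red_winv_left)
next
  fix u v w
  show "u \<otimes>\<^bsub>free_group A\<^esub> v \<otimes>\<^bsub>free_group A\<^esub> w = u \<otimes>\<^bsub>free_group A\<^esub> (v \<otimes>\<^bsub>free_group A\<^esub> w)"
    by simp
qed (auto simp: red_of_reduced)

lemma inv_free_group:
  "w \<in> carrier (free_group A) \<Longrightarrow> inv\<^bsub>free_group A\<^esub> w = red (winv w)"
  by (rule group.inv_equality[OF group_free_group]) (auto simp: red_winv_left)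

lemma hom_free_group_eqI:
  assumes "group G" "f \<in> hom (free_group A) G" "g \<in> hom (free_group A) G"
    and gens: "\<And>a. a \<in> A \<Longrightarrow> f [Inl a] = g [Inl a]"
    and "w \<in> carrier (free_group A)"
  shows "f w = g w"
proof -
  interpret f: group_hom "free_group A" G f
    using assms by (simp add: group_hom_def group_hom_axioms_def group_free_group)
  interpret g: group_hom "free_group A" G g
    using assms by (simp add: group_hom_def group_hom_axioms_def group_free_group)
  have letter: "f [x] = g [x]" if "x \<in> A <+> A" for x
  proof (cases x)
    case (Inl a)
    with that gens show ?thesis by auto
  next
    case (Inr a)
    with that have a: "a \<in> A" by auto
    have "inv\<^bsub>free_group A\<^esub> [Inl a] = [Inr a]" and "[Inl a] \<in> carrier (free_group A)"
      using a inv_free_group[of "[Inl a]" A]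
      by (auto simp: reduced_Cons winv_def linv_def red_Cons)
    then show ?thesis
      using f.hom_inv[of "[Inl a]"] g.hom_inv[of "[Inl a]"] gens[OF a] Inr by simp
  qed
  show ?thesis
    using \<open>w \<in> carrier (free_group A)\<close>
  proof (induction w)
    case Nil
    show ?case using f.hom_one g.hom_one by simp
  next
    case (Cons x w)
    then have mem: "[x] \<in> carrier (free_group A)" "w \<in> carrier (free_group A)"
      and x: "x \<in> A <+> A"
      by (auto simp: reduced_Cons)
    have "x # w = [x] \<otimes>\<^bsub>free_group A\<^esub> w"
      using Cons.prems by (simp add: red_of_reduced)
    then show ?case
      using f.hom_mult[OF mem] g.hom_mult[OF mem] letter[OF x] Cons.IH[OF mem(2)] by simp
  qed
qed


section \<open>Quotients of monoids by generated congruences\<close>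

lemma monoid_congruence_mult:
  assumes "monoid_congruence M \<theta>" "(a, b) \<in> \<theta>" "(c, d) \<in> \<theta>"
  shows "(a \<otimes>\<^bsub>M\<^esub> c, b \<otimes>\<^bsub>M\<^esub> d) \<in> \<theta>"
  using assms unfolding monoid_congruence_def by blast

lemma monoid_congruence_generated:
  assumes "monoid M" "R \<subseteq> carrier M \<times> carrier M"
  shows "monoid_congruence M (generated_congruence M R)"
proof -
  interpret monoid M by fact
  define C where "C = {\<theta>. monoid_congruence M \<theta> \<and> R \<subseteq> \<theta>}"
  \<comment> \<open>The family is nonempty, so its intersection is a relation on the carrier.\<close>
  have total: "carrier M \<times> carrier M \<in> C"
    using assms(2)
    by (auto simp: C_def monoid_congruence_def equiv_def refl_on_def sym_def trans_def)
  have C: "refl_on (carrier M) \<theta>" "sym \<theta>" "trans \<theta>" "monoid_congruence M \<theta>" if "\<theta> \<in> C" for \<theta>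
    using that by (simp_all add: C_def monoid_congruence_def equiv_def)
  have "equiv (carrier M) (\<Inter>C)"
  proof (rule equivI)
    show "\<Inter>C \<subseteq> carrier M \<times> carrier M"
      using total by (rule Inter_lower)
    show "refl_on (carrier M) (\<Inter>C)"
      by (rule refl_onI) (simp add: C(1)[THEN refl_onD])
    show "sym (\<Inter>C)"
      by (rule symI) (simp add: C(2)[THEN symD])
    show "trans (\<Inter>C)"
    proof (rule transI, rule InterI)
      fix a b c \<theta> assume "(a, b) \<in> \<Inter>C" "(b, c) \<in> \<Inter>C" and \<theta>: "\<theta> \<in> C"
      then have "(a, b) \<in> \<theta>" "(b, c) \<in> \<theta>" by simp_all
      then show "(a, c) \<in> \<theta>" by (rule transD[OF C(3)[OF \<theta>]])
    qed
  qed
  moreover have "(a \<otimes>\<^bsub>M\<^esub> c, b \<otimes>\<^bsub>M\<^esub> d) \<in> \<Inter>C" if "(a, b) \<in> \<Inter>C" "(c, d) \<in> \<Inter>C" for a b c d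
    using that by (simp add: C(4)[THEN monoid_congruence_mult])
  ultimately have "monoid_congruence M (\<Inter>C)"
    unfolding monoid_congruence_def by blast
  then show ?thesis
    by (simp add: generated_congruence_def hull_def C_def)
qed

locale monoid_cong = monoid M for M (structure) +
  fixes \<theta>
  assumes cong: "monoid_congruence M \<theta>"
begin

lemma equiv: "equiv (carrier M) \<theta>"
  using cong by (simp add: monoid_congruence_def)

lemma mult_class:
  assumes "a \<in> carrier M" "b \<in> carrier M"
  shows "\<theta> `` {a} \<otimes>\<^bsub>quotient_monoid M \<theta>\<^esub> \<theta> `` {b} = \<theta> `` {a \<otimes> b}"
proof -
  have "\<theta> `` {x \<otimes> y} = \<theta> `` {a \<otimes> b}" if "x \<in> \<theta> `` {a}" "y \<in> \<theta> `` {b}" for x y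
    using that monoid_congruence_mult[OF cong, of a x b y] equiv_class_eq[OF equiv] by blast
  moreover have "a \<in> \<theta> `` {a}" "b \<in> \<theta> `` {b}"
    using assms equiv_class_self[OF equiv] by auto
  ultimately have "(\<Union>x\<in>\<theta> `` {a}. \<Union>y\<in>\<theta> `` {b}. \<theta> `` {x \<otimes> y}) = \<theta> `` {a \<otimes> b}"
    by blast
  then show ?thesis
    by (simp add: quotient_monoid_def)
qed

lemma class_hom: "(\<lambda>a. \<theta> `` {a}) \<in> hom M (quotient_monoid M \<theta>)"
  by (auto simp: hom_def mult_class) (simp add: quotient_monoid_def quotientI)

lemma one_class: "\<one>\<^bsub>quotient_monoid M \<theta>\<^esub> = \<theta> `` {\<one>}"
  by (simp add: quotient_monoid_def)

lemma carrier_quotientE: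
  assumes "X \<in> carrier (quotient_monoid M \<theta>)"
  obtains a where "a \<in> carrier M" "X = \<theta> `` {a}"
  using assms by (auto simp: quotient_monoid_def elim: quotientE)

lemma monoid_quotient: "monoid (quotient_monoid M \<theta>)"
proof
  let ?Q = "quotient_monoid M \<theta>"
  note closed = hom_in_carrier[OF class_hom]
  fix X Y assume X: "X \<in> carrier ?Q" and Y: "Y \<in> carrier ?Q"
  then show "X \<otimes>\<^bsub>?Q\<^esub> Y \<in> carrier ?Q"
    by (auto elim!: carrier_quotientE simp: mult_class closed)
  fix Z assume "Z \<in> carrier ?Q"
  with X Y show "X \<otimes>\<^bsub>?Q\<^esub> Y \<otimes>\<^bsub>?Q\<^esub> Z = X \<otimes>\<^bsub>?Q\<^esub> (Y \<otimes>\<^bsub>?Q\<^esub> Z)"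
    by (auto elim!: carrier_quotientE simp: mult_class m_assoc)
qed (auto elim!: carrier_quotientE simp: mult_class one_class hom_in_carrier[OF class_hom])

end

lemma monoid_cong_generated:
  "monoid M \<Longrightarrow> R \<subseteq> carrier M \<times> carrier M \<Longrightarrow> monoid_cong M (generated_congruence M R)"
  by (simp add: monoid_cong_def monoid_cong_axioms_def monoid_congruence_generated)

text \<open>The kernel relation of a homomorphism is itself a congruence, so it contains the congruence
  generated by any relations that the homomorphism respects.\<close>

lemma hom_eq_on_generated_congruence:
  assumes "monoid M" "R \<subseteq> carrier M \<times> carrier M" "h \<in> hom M N"
    and rel: "\<And>a b. (a, b) \<in> R \<Longrightarrow> h a = h b"
    and ab: "(a, b) \<in> generated_congruence M R"
  shows "h a = h b"
proof -
  interpret monoid M by fact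
  let ?\<theta> = "{(a, b). a \<in> carrier M \<and> b \<in> carrier M \<and> h a = h b}"
  have "monoid_congruence M ?\<theta>"
    using \<open>h \<in> hom M N\<close>
    by (auto simp: monoid_congruence_def hom_mult intro!: equivI refl_onI symI transI)
  moreover have "R \<subseteq> ?\<theta>"
    using assms(2) rel by auto
  ultimately have "generated_congruence M R \<subseteq> ?\<theta>"
    unfolding generated_congruence_def by (rule hull_minimal[rotated])
  with ab show ?thesis by auto
qed

lemma hom_factors_through_generated_congruence:
  assumes M: "monoid M" and R: "R \<subseteq> carrier M \<times> carrier M" and h: "h \<in> hom M N"
    and rel: "\<And>a b. (a, b) \<in> R \<Longrightarrow> h a = h b"
  shows "\<exists>k \<in> hom (quotient_monoid M (generated_congruence M R)) N.
    \<forall>a\<in>carrier M. k (generated_congruence M R `` {a}) = h a"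
proof -
  let ?\<theta> = "generated_congruence M R"
  interpret monoid_cong M ?\<theta>
    using M R by (rule monoid_cong_generated)
  \<comment> \<open>By the previous lemma \<open>h\<close> is constant on each class, so any representative will do.\<close>
  define k where "k X = h (SOME a. a \<in> X)" for X
  have k: "k (?\<theta> `` {a}) = h a" if "a \<in> carrier M" for a
  proof -
    have "(SOME b. b \<in> ?\<theta> `` {a}) \<in> ?\<theta> `` {a}"
      using equiv_class_self[OF equiv that] by (rule someI)
    then have "(a, SOME b. b \<in> ?\<theta> `` {a}) \<in> ?\<theta>"
      by simp
    from hom_eq_on_generated_congruence[OF M R h rel this] show ?thesis
      by (simp add: k_def)
  qed
  have "k \<in> hom (quotient_monoid M ?\<theta>) N"
    using hom_in_carrier[OF h] hom_mult[OF h]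
    by (auto intro!: homI elim!: carrier_quotientE simp: mult_class k)
  with k show ?thesis by blast
qed


section \<open>Group presentations\<close>

lemma normal_normal_closure:
  assumes "group G" "S \<subseteq> carrier G"
  shows "normal_closure G S \<lhd> G"
proof -
  interpret group G by fact
  let ?F = "{N. N \<lhd> G \<and> S \<subseteq> N}"
  have ne: "carrier G \<in> ?F"
    using assms(2) by (auto simp: normal_inv_iff subgroup_self)
  have "subgroup (\<Inter>?F) G"
    using ne by (intro subgroups_Inter) (auto intro: normal_imp_subgroup)
  moreover have "x \<otimes>\<^bsub>G\<^esub> h \<otimes>\<^bsub>G\<^esub> inv\<^bsub>G\<^esub> x \<in> \<Inter>?F" if "x \<in> carrier G" "h \<in> \<Inter>?F" for x h
    using that by (auto simp: normal_inv_iff)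
  ultimately show ?thesis
    unfolding normal_closure_def hull_def normal_inv_iff by blast
qed

lemma normal_gp_kernel:
  assumes "R \<subseteq> gwords A \<times> gwords A"
  shows "gp_kernel A R \<lhd> free_group A"
  unfolding gp_kernel_def using assms
  by (intro normal_normal_closure group_free_group) auto

lemma group_Gp: "R \<subseteq> gwords A \<times> gwords A \<Longrightarrow> group (Gp A R)"
  unfolding Gp_def by (rule normal.factorgroup_is_group[OF normal_gp_kernel])

lemma one_Gp: "R \<subseteq> gwords A \<times> gwords A \<Longrightarrow> \<one>\<^bsub>Gp A R\<^esub> = gp_kernel A R"
  by (simp add: Gp_def FactGroup_def)

lemma gp_elem_red [simp]: "gp_elem A R (red w) = gp_elem A R w"
  by (simp add: gp_elem_def red_of_reduced)

lemma gp_elem_hom: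
  assumes "R \<subseteq> gwords A \<times> gwords A"
  shows "gp_elem A R \<in> hom (free_group A) (Gp A R)"
proof -
  have "(\<lambda>w. gp_kernel A R #>\<^bsub>free_group A\<^esub> w) \<in> hom (free_group A) (Gp A R)"
    unfolding Gp_def by (rule normal.r_coset_hom_Mod[OF normal_gp_kernel[OF assms]])
  then show ?thesis
    by (auto simp: hom_def gp_elem_def red_of_reduced)
qed

lemma gp_elem_append:
  assumes "R \<subseteq> gwords A \<times> gwords A" "u \<in> gwords A" "v \<in> gwords A"
  shows "gp_elem A R (u @ v) = gp_elem A R u \<otimes>\<^bsub>Gp A R\<^esub> gp_elem A R v"
  using hom_mult[OF gp_elem_hom[OF assms(1)], of "red u" "red v"] assms(2,3) by simp

lemma gp_elem_Nil:
  assumes "R \<subseteq> gwords A \<times> gwords A"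
  shows "gp_elem A R [] = \<one>\<^bsub>Gp A R\<^esub>"
  using hom_one[OF gp_elem_hom[OF assms] group_free_group group_Gp[OF assms]] by simp

lemma gp_elem_closed:
  assumes "R \<subseteq> gwords A \<times> gwords A" "w \<in> gwords A"
  shows "gp_elem A R w \<in> carrier (Gp A R)"
  using hom_in_carrier[OF gp_elem_hom[OF assms(1)], of "red w"] assms(2) by simp

lemma carrier_GpE:
  assumes "X \<in> carrier (Gp A R)"
  obtains w where "w \<in> carrier (free_group A)" "X = gp_elem A R w"
  using assms by (auto simp: Gp_def FactGroup_def RCOSETS_def gp_elem_def red_of_reduced)

text \<open>The kernel contains \<open>u v\<^sup>-\<^sup>1\<close>, so \<open>u\<close> and \<open>v\<close> both become inverse to \<open>v\<^sup>-\<^sup>1\<close>, and \<open>v\<^sup>-\<^sup>1\<close> cancels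
  in the quotient.\<close>

lemma gp_elem_relation:
  assumes R: "R \<subseteq> gwords A \<times> gwords A" and uv: "(u, v) \<in> R"
  shows "gp_elem A R u = gp_elem A R v"
proof -
  interpret G: group "Gp A R" using R by (rule group_Gp)
  have mem: "u \<in> gwords A" "v \<in> gwords A" using R uv by auto
  have "red (u @ winv v) \<in> gp_kernel A R"
    unfolding gp_kernel_def normal_closure_def using uv by (intro hull_inc) force
  then have "gp_elem A R (u @ winv v) = \<one>\<^bsub>Gp A R\<^esub>"
    using normal_imp_subgroup[OF normal_gp_kernel[OF R]] mem
    by (simp add: gp_elem_def one_Gp[OF R] group.coset_join2[OF group_free_group])
  also have "\<dots> = gp_elem A R (v @ winv v)"
    using gp_elem_Nil[OF R] gp_elem_red[of A R "v @ winv v"] by (simp add: red_winv_right)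
  finally show ?thesis
    using mem gp_elem_closed[OF R] by (simp add: gp_elem_append[OF R])
qed

lemma hom_factors_through_Gp:
  assumes R: "R \<subseteq> gwords A \<times> gwords A" and "group N" and h: "h \<in> hom (free_group A) N"
    and rel: "\<And>u v. (u, v) \<in> R \<Longrightarrow> h (red (u @ winv v)) = \<one>\<^bsub>N\<^esub>"
  shows "\<exists>k \<in> hom (Gp A R) N. \<forall>w\<in>carrier (free_group A). k (gp_elem A R w) = h w"
proof -
  interpret group_hom "free_group A" N h
    using h \<open>group N\<close> by (simp add: group_hom_def group_hom_axioms_def group_free_group)
  have "(\<lambda>(u, v). red (u @ winv v)) ` R \<subseteq> kernel (free_group A) N h"
    using R rel by (fastforce simp: kernel_def)
  then have "gp_kernel A R \<subseteq> kernel (free_group A) N h"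
    unfolding gp_kernel_def normal_closure_def by (rule hull_minimal) (rule normal_kernel)
  with normal_gp_kernel[OF R]
  obtain k where k: "k \<in> hom (free_group A Mod gp_kernel A R) N"
    and "\<And>w. w \<in> carrier (free_group A) \<Longrightarrow> k (gp_kernel A R #>\<^bsub>free_group A\<^esub> w) = h w"
    by (rule FactGroup_universal_kernel) (rule that)
  then have "k (gp_elem A R w) = h w" if "w \<in> carrier (free_group A)" for w
    using that by (simp add: gp_elem_def red_of_reduced)
  with k show ?thesis
    unfolding Gp_def by blast
qed


section \<open>Free reduction of words that represent units\<close>

text \<open>The properties of the evaluation of words in an inverse monoid that interact with free reduction:
  a monoid homomorphism that satisfies both families of relations defining Vagner's congruence.\<close>

locale inverse_word_map = monoid N for N (structure) +
  fixes A :: "'a set" and h :: "'a gword \<Rightarrow> 'b"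
  assumes closed: "w \<in> gwords A \<Longrightarrow> h w \<in> carrier N"
    and append: "u \<in> gwords A \<Longrightarrow> v \<in> gwords A \<Longrightarrow> h (u @ v) = h u \<otimes> h v"
    and Nil: "h [] = \<one>"
    and winv_regular: "w \<in> gwords A \<Longrightarrow> h (w @ winv w @ w) = h w"
    and idempotents_commute: "u \<in> gwords A \<Longrightarrow> v \<in> gwords A \<Longrightarrow>
      h (u @ winv u @ v @ winv v) = h (v @ winv v @ u @ winv u)"
begin

lemma eq_prefix:
  "u \<in> gwords A \<Longrightarrow> v \<in> gwords A \<Longrightarrow> w \<in> gwords A \<Longrightarrow> h u = h v \<Longrightarrow> h (w @ u) = h (w @ v)"
  by (simp add: append)

lemma eq_suffix:
  "u \<in> gwords A \<Longrightarrow> v \<in> gwords A \<Longrightarrow> w \<in> gwords A \<Longrightarrow> h u = h v \<Longrightarrow> h (u @ w) = h (v @ w)"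
  by (simp add: append)

text \<open>In the natural partial order of an inverse monoid a word lies below its free reduction, because
  deleting \<open>x x\<^sup>-\<^sup>1\<close> removes an idempotent factor. The multiplying idempotent can be taken to
  be \<open>w w\<^sup>-\<^sup>1\<close>, and with this choice the induction over the letters of \<open>w\<close> closes.\<close>

lemma eq_idempotent_red:
  assumes "w \<in> gwords A"
  shows "h w = h (w @ winv w @ red w)"
  using assms
proof (induction w)
  case (Cons x w)
  then have x: "x \<in> A <+> A" "[x] \<in> gwords A" and w: "w \<in> gwords A" by auto
  have r: "red w \<in> gwords A" using w by simp
  let ?e = "x # w @ winv w @ [linv x]"
  \<comment> \<open>Move the idempotent of \<open>w\<close> to the left of the letter \<open>x\<close>, as the idempotent of \<open>x w\<close>,
    by inserting \<open>x\<^sup>-\<^sup>1 x\<close> next to it.\<close>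
  have "h (x # w) = h ([x] @ w)" by simp
  also have "\<dots> = h ([x] @ w @ winv w @ red w)"
    using Cons.IH[OF w] x w r by (intro eq_prefix) auto
  also have "\<dots> = h (([x] @ [linv x] @ [x]) @ w @ winv w @ red w)"
    using winv_regular[of "[x]"] x w r by (intro eq_suffix) (auto simp: winv_Cons)
  also have "\<dots> = h ([x] @ ([linv x] @ [x] @ w @ winv w) @ red w)"
    by simp
  also have "\<dots> = h ([x] @ (w @ winv w @ [linv x] @ [x]) @ red w)"
    using idempotents_commute[of "[linv x]" w] x w r
    by (intro eq_prefix eq_suffix) (auto simp: winv_Cons)
  finally have step: "h (x # w) = h (?e @ x # red w)"
    by simp
  show ?case
  proof (cases "red (x # w) = x # red w")
    case True
    with step show ?thesis by (simp add: winv_Cons)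
  next
    case False
    then obtain z where z: "red w = linv x # z" "red (x # w) = z"
      by (cases "red w") (auto simp: red_Cons split: if_splits)
    then have zw: "z \<in> gwords A" using r by simp
    \<comment> \<open>The cancelled pair \<open>x x\<^sup>-\<^sup>1\<close> commutes past the idempotent of \<open>x w\<close>, whose first letter \<open>x\<close>
      absorbs it.\<close>
    have "h (?e @ x # red w) = h ((?e @ [x, linv x]) @ z)"
      using z by simp
    also have "\<dots> = h (([x, linv x] @ ?e) @ z)"
      using idempotents_commute[of "x # w" "[x]"] x w zw
      by (intro eq_suffix) (auto simp: winv_Cons)
    also have "\<dots> = h ([x, linv x, x] @ w @ winv w @ [linv x] @ z)"
      by simp
    also have "\<dots> = h ([x] @ w @ winv w @ [linv x] @ z)"
      using winv_regular[of "[x]"] x w zw by (intro eq_suffix) (auto simp: winv_Cons)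
    finally show ?thesis
      using step z by (simp add: winv_Cons)
  qed
qed simp

text \<open>Cancelling the unit \<open>w\<close> in \<open>w w\<^sup>-\<^sup>1 w = w\<close> shows that the formal inverse of \<open>w\<close> represents the
  inverse of the unit.\<close>

lemma winv_of_unit:
  assumes w: "w \<in> gwords A" and unit: "h w \<in> Units N"
  shows "h w \<otimes> h (winv w) = \<one>" "h (winv w) \<in> Units N"
proof -
  have "h w \<otimes> h (winv w) \<otimes> h w = h w"
    using winv_regular[OF w] w by (simp add: append closed m_assoc)
  then have "h w \<otimes> h (winv w) \<otimes> h w = \<one> \<otimes> h w"
    using w by (simp add: closed)
  then have "h w \<otimes> h (winv w) \<otimes> h w \<otimes> inv (h w) = \<one> \<otimes> h w \<otimes> inv (h w)"
    by simp
  then show right: "h w \<otimes> h (winv w) = \<one>"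
    using unit w by (simp add: closed m_assoc)
  have "h (winv w) = inv (h w) \<otimes> (h w \<otimes> h (winv w))"
    using unit w by (simp add: closed m_assoc[symmetric])
  then show "h (winv w) \<in> Units N"
    using unit by (simp add: right)
qed

text \<open>The key fact: for a unit the idempotent \<open>w w\<^sup>-\<^sup>1\<close> is the identity, so free reduction, which in
  general moves an element up in the natural partial order, leaves units unchanged.\<close>

lemma red_of_unit:
  assumes w: "w \<in> gwords A" and unit: "h w \<in> Units N"
  shows "h (red w) = h w"
proof -
  have "h w = h w \<otimes> h (winv w) \<otimes> h (red w)"
    using eq_idempotent_red[OF w] w by (simp add: append closed m_assoc)
  then show ?thesis
    using winv_of_unit(1)[OF assms] w by (simp add: closed)
qed

definition unit_elements :: "'a gword set" where
  "unit_elements = {w \<in> carrier (free_group A). h w \<in> Units N}"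

lemma unit_append_red:
  assumes "u \<in> gwords A" "v \<in> gwords A" "h u \<in> Units N" "h v \<in> Units N"
  shows "h (red (u @ v)) = h u \<otimes> h v"
  using assms by (simp add: red_of_unit append)

lemma subgroup_unit_elements: "subgroup unit_elements (free_group A)"
proof (rule group.subgroupI[OF group_free_group])
  have "[] \<in> unit_elements" by (simp add: unit_elements_def Nil)
  then show "unit_elements \<noteq> {}" by blast
next
  fix u assume "u \<in> unit_elements"
  then show "inv\<^bsub>free_group A\<^esub> u \<in> unit_elements"
    by (auto simp: unit_elements_def inv_free_group red_of_unit winv_of_unit(2))
next
  fix u v assume "u \<in> unit_elements" "v \<in> unit_elements"
  then show "u \<otimes>\<^bsub>free_group A\<^esub> v \<in> unit_elements"
    by (auto simp: unit_elements_def unit_append_red)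
qed (auto simp: unit_elements_def)

lemma group_hom_unit_elements:
  "group_hom (free_group A\<lparr>carrier := unit_elements\<rparr>) (units_of N) h"
proof -
  have "group (free_group A\<lparr>carrier := unit_elements\<rparr>)"
    using group.subgroup_imp_group[OF group_free_group subgroup_unit_elements] .
  moreover have "h \<in> hom (free_group A\<lparr>carrier := unit_elements\<rparr>) (units_of N)"
    by (auto simp: hom_def unit_elements_def units_of_carrier units_of_mult unit_append_red)
  ultimately show ?thesis
    by (simp add: group_hom_def group_hom_axioms_def units_group)
qed

text \<open>Evaluation is not multiplicative on the free group, where products are reduced, but it is on the
  subgroup of reduced words representing units. The subgroup generated by the reduced forms of words
  in \<open>S\<close> lies inside it.\<close>

lemma epi_subgroup_generated_units:
  assumes S: "S \<subseteq> gwords A" and units: "h ` S \<subseteq> Units N"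
  shows "h \<in> epi (subgroup_generated (free_group A) (red ` S)) (subgroup_generated (units_of N) (h ` S))"
proof -
  interpret group_hom "free_group A\<lparr>carrier := unit_elements\<rparr>" "units_of N" h
    by (rule group_hom_unit_elements)
  let ?G = "subgroup_generated (free_group A) (red ` S)"
  let ?K = "subgroup_generated (units_of N) (h ` S)"
  have S_units: "red ` S \<subseteq> unit_elements"
    using S units by (auto simp: unit_elements_def red_of_unit subset_eq)
  have "carrier ?G = generate (free_group A) (red ` S)"
    using S by (simp add: subgroup_generated_def Int_absorb1 image_subset_iff subset_eq)
  also have "\<dots> = generate (free_group A\<lparr>carrier := unit_elements\<rparr>) (red ` S)"
    using group.generate_consistent[OF group_free_group S_units subgroup_unit_elements] by simp
  finally have carrier_G:
    "carrier ?G = generate (free_group A\<lparr>carrier := unit_elements\<rparr>) (red ` S)" .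
  have h_red: "h ` red ` S = h ` S"
    using S units unfolding image_image by (intro image_cong refl red_of_unit) auto
  have "carrier ?K = generate (units_of N) (h ` red ` S)"
    using units by (simp add: subgroup_generated_def units_of_carrier Int_absorb1 h_red)
  also have "\<dots> = h ` carrier ?G"
    using generate_img[of "red ` S"] S_units by (simp add: carrier_G)
  finally have onto: "h ` carrier ?G = carrier ?K" by simp
  moreover have "carrier ?G \<subseteq> unit_elements"
    using G.generate_incl[of "red ` S"] S_units by (simp add: carrier_G)
  then have "h (u \<otimes>\<^bsub>?G\<^esub> v) = h u \<otimes>\<^bsub>?K\<^esub> h v" if "u \<in> carrier ?G" "v \<in> carrier ?G" for u v
    using that hom_mult[of u v] by (auto simp: subgroup_generated_def)
  ultimately show ?thesis
    by (auto simp: epi_def hom_def)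
qed

end

section \<open>Inverse monoid presentations\<close>

lemma free_monoid_simps [simp]:
  "carrier (free_monoid A) = gwords A"
  "u \<otimes>\<^bsub>free_monoid A\<^esub> v = u @ v"
  "\<one>\<^bsub>free_monoid A\<^esub> = []"
  by (simp_all add: free_monoid_def)

lemma monoid_free_monoid: "monoid (free_monoid A)"
  by unfold_locales auto

definition vagner_relations :: "'a set \<Rightarrow> ('a gword \<times> 'a gword) set" where
  "vagner_relations A =
    {(w @ winv w @ w, w) | w. w \<in> gwords A} \<union>
    {(u @ winv u @ v @ winv v, v @ winv v @ u @ winv u) | u v. u \<in> gwords A \<and> v \<in> gwords A}"

lemma vagner_congruence_eq:
  "vagner_congruence A = generated_congruence (free_monoid A) (vagner_relations A)"
  by (simp add: vagner_congruence_def vagner_relations_def)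

lemma vagner_relations_subset: "vagner_relations A \<subseteq> carrier (free_monoid A) \<times> carrier (free_monoid A)"
  by (auto simp: vagner_relations_def)

interpretation vagner: monoid_cong "free_monoid A" "vagner_congruence A" for A
  unfolding vagner_congruence_eq
  by (rule monoid_cong_generated[OF monoid_free_monoid vagner_relations_subset])

lemma monoid_free_inverse_monoid: "monoid (free_inverse_monoid A)"
  unfolding free_inverse_monoid_def by (rule vagner.monoid_quotient)

lemma fim_elem_hom: "fim_elem A \<in> hom (free_monoid A) (free_inverse_monoid A)"
  unfolding free_inverse_monoid_def fim_elem_def by (rule vagner.class_hom)

lemma fim_elem_vagner:
  assumes "(u, v) \<in> vagner_relations A"
  shows "fim_elem A u = fim_elem A v"
proof -
  have "(u, v) \<in> vagner_congruence A"
    using assms unfolding vagner_congruence_eq generated_congruence_def by (rule hull_inc)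
  then show ?thesis
    unfolding fim_elem_def by (rule equiv_class_eq[OF vagner.equiv])
qed

lemma fim_relations_subset:
  assumes "R \<subseteq> gwords A \<times> gwords A"
  shows "map_prod (fim_elem A) (fim_elem A) ` R
    \<subseteq> carrier (free_inverse_monoid A) \<times> carrier (free_inverse_monoid A)"
  using assms hom_in_carrier[OF fim_elem_hom] by fastforce

lemma monoid_cong_inv_congruence:
  "R \<subseteq> gwords A \<times> gwords A \<Longrightarrow> monoid_cong (free_inverse_monoid A) (inv_congruence A R)"
  unfolding inv_congruence_def
  by (rule monoid_cong_generated[OF monoid_free_inverse_monoid fim_relations_subset])

lemma monoid_Inv: "R \<subseteq> gwords A \<times> gwords A \<Longrightarrow> monoid (Inv A R)"
  unfolding Inv_def by (rule monoid_cong.monoid_quotient[OF monoid_cong_inv_congruence])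

lemma inverse_word_map_Inv:
  assumes R: "R \<subseteq> gwords A \<times> gwords A"
  shows "inverse_word_map (Inv A R) A (inv_elem A R)"
proof -
  interpret R: monoid_cong "free_inverse_monoid A" "inv_congruence A R"
    using R by (rule monoid_cong_inv_congruence)
  interpret monoid "Inv A R" using R by (rule monoid_Inv)
  have vagner: "inv_elem A R u = inv_elem A R v" if "(u, v) \<in> vagner_relations A" for u v
    using fim_elem_vagner[OF that] by (simp add: inv_elem_def)
  show ?thesis
  proof
    fix u v assume "u \<in> gwords A" "v \<in> gwords A"
    then show "inv_elem A R (u @ v) = inv_elem A R u \<otimes>\<^bsub>Inv A R\<^esub> inv_elem A R v"
      using hom_mult[OF fim_elem_hom, of u A v] hom_in_carrier[OF fim_elem_hom, of _ A]
      by (simp add: inv_elem_def Inv_def R.mult_class)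
  next
    fix w assume "w \<in> gwords A"
    then show "inv_elem A R w \<in> carrier (Inv A R)"
      unfolding inv_elem_def Inv_def
      by (intro hom_in_carrier[OF R.class_hom] hom_in_carrier[OF fim_elem_hom]) simp
  next
    have "\<one>\<^bsub>free_inverse_monoid A\<^esub> = fim_elem A []"
      by (simp add: free_inverse_monoid_def fim_elem_def vagner.one_class)
    then show "inv_elem A R [] = \<one>\<^bsub>Inv A R\<^esub>"
      by (simp add: inv_elem_def Inv_def R.one_class)
  qed (auto intro!: vagner simp: vagner_relations_def)
qed

lemma inv_elem_relation:
  assumes R: "R \<subseteq> gwords A \<times> gwords A" and uv: "(u, v) \<in> R"
  shows "inv_elem A R u = inv_elem A R v"
proof -
  interpret R: monoid_cong "free_inverse_monoid A" "inv_congruence A R"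
    using R by (rule monoid_cong_inv_congruence)
  have "(fim_elem A u, fim_elem A v) \<in> inv_congruence A R"
    unfolding inv_congruence_def generated_congruence_def
    using uv by (intro hull_inc) force
  then show ?thesis
    unfolding inv_elem_def by (rule equiv_class_eq[OF R.equiv])
qed

text \<open>The maximal group image of the inverse monoid: Vagner's relations hold in every group, so the map
  from words to the group factors first through the free inverse monoid and then, as the relations in
  \<open>R\<close> hold too, through \<open>Inv A R\<close>.\<close>

lemma gp_elem_eq_if_inv_elem_eq:
  assumes R: "R \<subseteq> gwords A \<times> gwords A"
    and uv: "u \<in> gwords A" "v \<in> gwords A" "inv_elem A R u = inv_elem A R v"
  shows "gp_elem A R u = gp_elem A R v"
proof -
  have "gp_elem A R \<in> hom (free_monoid A) (Gp A R)"
    by (auto intro!: homI simp: gp_elem_closed[OF R] gp_elem_append[OF R])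
  moreover have "gp_elem A R x = gp_elem A R y" if "(x, y) \<in> vagner_relations A" for x y
  proof -
    have "red x = red y"
      using that by (auto simp: vagner_relations_def red_winv_right red_winv_right_append)
    then have "gp_elem A R (red x) = gp_elem A R (red y)" by (rule arg_cong)
    then show ?thesis by simp
  qed
  ultimately obtain k where k: "k \<in> hom (free_inverse_monoid A) (Gp A R)"
    and k_fim: "\<And>w. w \<in> carrier (free_monoid A) \<Longrightarrow> k (fim_elem A w) = gp_elem A R w"
    using hom_factors_through_generated_congruence
      [OF monoid_free_monoid vagner_relations_subset, of "gp_elem A R" A "Gp A R",
        folded vagner_congruence_eq free_inverse_monoid_def fim_elem_def]
    by blast
  have k_R: "k X = k Z" if "(X, Z) \<in> map_prod (fim_elem A) (fim_elem A) ` R" for X Z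
  proof -
    from that obtain x z where xz: "(x, z) \<in> R" "X = fim_elem A x" "Z = fim_elem A z"
      by auto
    then have "x \<in> gwords A" "z \<in> gwords A"
      using R by auto
    then show ?thesis
      using gp_elem_relation[OF R xz(1)] by (simp add: xz k_fim)
  qed
  obtain l where "\<And>X. X \<in> carrier (free_inverse_monoid A) \<Longrightarrow> l (inv_congruence A R `` {X}) = k X"
    using hom_factors_through_generated_congruence
      [OF monoid_free_inverse_monoid fim_relations_subset[OF R] k k_R, folded inv_congruence_def]
    by blast
  then have "l (inv_elem A R w) = gp_elem A R w" if "w \<in> gwords A" for w
    using that hom_in_carrier[OF fim_elem_hom, of w A] by (simp add: inv_elem_def k_fim)
  with uv show ?thesis by metis
qed


section \<open>The subgroup generated by the pieces\<close>

theorem theorem3p1: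
  fixes A :: "'a set" and Y :: "'y set" and I :: "'i set"
    and r :: "'i \<Rightarrow> 'a gword"
    and p :: "'i \<Rightarrow> 'a gword list"
    and \<phi> :: "'y gword \<Rightarrow> 'a gword"
  assumes r_words: "\<And>i. i \<in> I \<Longrightarrow> r i \<in> gwords A"
    and R: "R = special_relations I r"
    and M: "M = Inv A R"
    and factorisation: "\<And>i. i \<in> I \<Longrightarrow> r i = concat (p i)"
    and pieces: "pieces = (\<Union>i\<in>I. set (p i))"
    and invertible: "\<And>u. u \<in> pieces \<Longrightarrow> inv_elem A R u \<in> Units M"
    and H: "H = subgroup_generated (free_group A) (red ` pieces)"
    and iso: "\<phi> \<in> iso (free_group Y) H"
    and q: "\<And>i. q i = concat (map (\<lambda>u. inv_into (carrier (free_group Y)) \<phi> (red u)) (p i))"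
    and Q: "Q = special_relations I q"
    and K: "K = Gp Y Q"
    and embedding: "\<exists>f \<in> mon K (Gp A R). \<forall>y\<in>Y. f (gp_elem Y Q [Inl y]) = gp_elem A R (\<phi> [Inl y])"
  shows "\<exists>f \<in> iso K (subgroup_generated (units_of M) (inv_elem A R ` pieces)).
           \<forall>y\<in>Y. f (gp_elem Y Q [Inl y]) = inv_elem A R (\<phi> [Inl y])"
proof -
  let ?FA = "free_group A" and ?FY = "free_group Y"
  let ?S = "subgroup_generated (units_of M) (inv_elem A R ` pieces)"
  define \<psi> where "\<psi> u = inv_into (carrier ?FY) \<phi> (red u)" for u
  have R_words: "R \<subseteq> gwords A \<times> gwords A"
    using r_words by (auto simp: R special_relations_def)
  have pieces_words: "pieces \<subseteq> gwords A"
    using r_words factorisation by (fastforce simp: pieces)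
  interpret inverse_word_map M A "inv_elem A R"
    unfolding M using R_words by (rule inverse_word_map_Inv)
  have S: "group ?S"
    by (rule group.group_subgroup_generated[OF units_group])
  have pieces_to_M: "inv_elem A R \<in> epi H ?S"
    unfolding H using pieces_words invertible by (intro epi_subgroup_generated_units) auto
  have H_mult: "x \<otimes>\<^bsub>H\<^esub> y = red (x @ y)" for x y
    by (simp add: H subgroup_generated_def)
  have H_subset: "carrier H \<subseteq> carrier ?FA"
    unfolding H by (rule group.carrier_subgroup_generated_subset[OF group_free_group])
  have \<phi>_hom: "\<phi> \<in> hom ?FY H" and \<phi>_onto: "\<phi> ` carrier ?FY = carrier H"
    using iso by (auto simp: iso_def bij_betw_def)
  have \<psi>: "\<psi> u \<in> carrier ?FY" "\<phi> (\<psi> u) = red u" if "u \<in> pieces" for u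
  proof -
    have "red u \<in> carrier H"
      unfolding H using that pieces_words
      by (auto simp: subgroup_generated_def intro!: generate.incl)
    then show "\<psi> u \<in> carrier ?FY" "\<phi> (\<psi> u) = red u"
      unfolding \<psi>_def \<phi>_onto[symmetric] by (rule inv_into_into, rule f_inv_into_f)
  qed
  have \<phi>_concat: "\<phi> (red (concat (map \<psi> us))) = red (concat us)"
    if "set us \<subseteq> pieces" for us
    using that
  proof (induction us)
    case Nil
    have "group H" unfolding H by (rule group.group_subgroup_generated[OF group_free_group])
    then show ?case
      using hom_one[OF \<phi>_hom group_free_group] by (simp add: H subgroup_generated_def)
  next
    case (Cons u us)
    then have u: "u \<in> pieces" and us: "set us \<subseteq> pieces" by auto
    have "concat (map \<psi> us) \<in> gwords Y"
      using us \<psi>(1) by auto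
    then have "red (concat (map \<psi> us)) \<in> carrier ?FY"
      by simp
    from hom_mult[OF \<phi>_hom \<psi>(1)[OF u] this] show ?case
      by (simp add: H_mult \<psi>(2)[OF u] Cons.IH[OF us])
  qed
  have q_concat: "q i = concat (map \<psi> (p i))" for i
    unfolding q \<psi>_def ..
  have p_pieces: "set (p i) \<subseteq> pieces" if "i \<in> I" for i
    using that by (auto simp: pieces)
  have Q_words: "Q \<subseteq> gwords Y \<times> gwords Y"
    using p_pieces \<psi>(1) by (fastforce simp: Q special_relations_def q_concat)
  interpret K: group K
    unfolding K using Q_words by (rule group_Gp)

  \<comment> \<open>Evaluation in \<open>M\<close> after \<open>\<phi>\<close> kills the relators of \<open>K\<close>, since these are sent to the reduced
    forms of the \<open>r i\<close>; hence it descends to \<open>K\<close>.\<close>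
  have M_hom: "inv_elem A R \<circ> \<phi> \<in> hom ?FY ?S"
    using \<phi>_hom pieces_to_M by (auto simp: epi_def intro: hom_compose)
  have "(inv_elem A R \<circ> \<phi>) (red (u @ winv v)) = \<one>\<^bsub>?S\<^esub>" if "(u, v) \<in> Q" for u v
  proof -
    from that obtain i where i: "i \<in> I" "u = q i" "v = []"
      by (auto simp: Q special_relations_def)
    have "inv_elem A R (r i) = \<one>\<^bsub>M\<^esub>"
      using inv_elem_relation[OF R_words, of "r i" "[]"] i(1) Nil
      by (auto simp: R special_relations_def)
    then have "inv_elem A R (red (r i)) = \<one>\<^bsub>M\<^esub>"
      using red_of_unit[OF r_words[OF i(1)]] by simp
    then show ?thesis
      using \<phi>_concat[OF p_pieces[OF i(1)]] factorisation[OF i(1)] i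
      by (simp add: q_concat subgroup_generated_def units_of_one)
  qed
  with Q_words S M_hom obtain k where k_hom: "k \<in> hom (Gp Y Q) ?S"
    and k: "\<And>w. w \<in> carrier ?FY \<Longrightarrow> k (gp_elem Y Q w) = (inv_elem A R \<circ> \<phi>) w"
    using hom_factors_through_Gp[of Q Y ?S "inv_elem A R \<circ> \<phi>"] by blast
  obtain e where e: "e \<in> mon K (Gp A R)"
    and e_gens: "\<And>y. y \<in> Y \<Longrightarrow> e (gp_elem Y Q [Inl y]) = gp_elem A R (\<phi> [Inl y])"
    using embedding by blast
  have e_elem: "e (gp_elem Y Q w) = gp_elem A R (\<phi> w)" if w: "w \<in> carrier ?FY" for w
  proof -
    have "e \<circ> gp_elem Y Q \<in> hom ?FY (Gp A R)"
      using e gp_elem_hom[OF Q_words] by (auto simp: mon_def K intro: hom_compose)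
    moreover have "gp_elem A R \<circ> \<phi> \<in> hom ?FY (Gp A R)"
    proof (rule hom_compose[OF \<phi>_hom])
      show "gp_elem A R \<in> hom H (Gp A R)"
        unfolding H
        by (rule group.hom_from_subgroup_generated[OF group_free_group gp_elem_hom[OF R_words]])
    qed
    ultimately have "(e \<circ> gp_elem Y Q) w = (gp_elem A R \<circ> \<phi>) w"
      by (rule hom_free_group_eqI[OF group_Gp[OF R_words]]) (simp add: e_gens, rule w)
    then show ?thesis by simp
  qed

  interpret k: group_hom K ?S k
    using k_hom S K.is_group by (simp add: group_hom_def group_hom_axioms_def K)
  \<comment> \<open>Surjectivity holds because \<open>\<phi>\<close> maps onto \<open>H\<close>. For injectivity, an element that becomes trivial
    in \<open>M\<close> is also trivial in the maximal group image of \<open>M\<close>, where \<open>e\<close> embeds \<open>K\<close>.\<close>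
  have "k \<in> iso K ?S"
    unfolding k.iso_iff
  proof (intro conjI ballI impI subsetI)
    fix s assume s: "s \<in> carrier ?S"
    have "carrier ?S = inv_elem A R ` \<phi> ` carrier ?FY"
      unfolding \<phi>_onto using pieces_to_M by (simp add: epi_def)
    with s obtain w where w: "w \<in> carrier ?FY" "s = inv_elem A R (\<phi> w)"
      by blast
    then have "s = k (gp_elem Y Q w)"
      by (simp add: k)
    moreover have "gp_elem Y Q w \<in> carrier K"
      unfolding K using gp_elem_hom[OF Q_words] w(1) by (rule hom_in_carrier)
    ultimately show "s \<in> k ` carrier K" by blast
  next
    fix x assume "x \<in> carrier K" and kx: "k x = \<one>\<^bsub>?S\<^esub>"
    then obtain w where w: "w \<in> carrier ?FY" "x = gp_elem Y Q w"
      unfolding K by (elim carrier_GpE)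
    have "inv_elem A R (\<phi> w) = inv_elem A R []"
      using kx w k Nil by (simp add: subgroup_generated_def units_of_one)
    moreover have "\<phi> w \<in> gwords A"
      using hom_in_carrier[OF \<phi>_hom w(1)] H_subset by auto
    ultimately have "gp_elem A R (\<phi> w) = \<one>\<^bsub>Gp A R\<^esub>"
      using gp_elem_eq_if_inv_elem_eq[OF R_words, of "\<phi> w" "[]"] gp_elem_Nil[OF R_words] by simp
    then have "e x = \<one>\<^bsub>Gp A R\<^esub>"
      using e_elem w by simp
    then show "x = \<one>\<^bsub>K\<^esub>"
      using e \<open>x \<in> carrier K\<close> K.is_group by (simp add: mon_iff_hom_one group_Gp[OF R_words])
  qed
  moreover have "k (gp_elem Y Q [Inl y]) = inv_elem A R (\<phi> [Inl y])" if "y \<in> Y" for y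
    using k[of "[Inl y]"] that by (simp add: reduced_Cons InlI)
  ultimately show ?thesis by blast
qed

end
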